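(* Let $D$ be the formal derivative associated with the context-free grammar $$G'=\{x\rightarrow xyz,\ y\rightarrow yz^2,\ z\rightarrow y^2z\}.$$ Then for every integer $n\ge 1$, $$D^n(x)=x\sum_{k=1}^{2n-1}T(n,k)y^kz^{2n-k},$$ $$D^n(x^2)=2x^2(y+z)^{n-1}\sum_{k=1}^{n}\genfrac{<}{>}{0pt}{}{n}{k}y^kz^{n-k+1}.$$ In particular, setting $x=z=1$, one has $D^n(x)|_{x=z=1}=T_n(y)$ and $D^n(x^2)|_{x=z=1}=2(1+y)^{n-1}A_n(y)$.
   Context: Formal derivative of a grammar: $D$ is the unique $\mathbb{Q}$-linear derivation (satisfying the Leibniz rule $D(uv)=D(u)v+uD(v)$) on the commutative polynomial ring $\mathbb{Q}[x,y,z]$ (or the formal power series ring) with $D(x)=xyz$, $D(y)=yz^2$, $D(z)=y^2z$; $D^n$ denotes its $n$-fold iterate. Definition of $T(n,k)$ and $T_n$: let $\vartheta=x\frac{d}{dx}$ and $r(x)=\frac{\sqrt{1+x}}{\sqrt{1-x}}$. For $n\ge 1$ there are (uniquely determined) positive integers $T(n,k)$, $1\le k\le 2n-1$, such that $$\vartheta^n(r(x))=\frac{\sum_{k=1}^{2n-1}T(n,k)x^k}{(1-x)^n(1+x)^{n-1}\sqrt{1-x^2}},$$ and $T_n(x)=\sum_{k=1}^{2n-1}T(n,k)x^k$. Eulerian polynomials and numbers: for a permutation $\pi$ in the symmetric group $\mathfrak{S}_n$, $\mathrm{des}(\pi)$ is the number of $i\in\{1,\ldots,n-1\}$ with $\pi(i)>\pi(i+1)$,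 and $A_n(x)=\sum_{\pi\in\mathfrak{S}_n}x^{\mathrm{des}(\pi)+1}=\sum_{k=1}^n\genfrac{<}{>}{0pt}{}{n}{k}x^k$. Thus $\genfrac{<}{>}{0pt}{}{n}{k}$ is the number of $\pi\in\mathfrak{S}_n$ with exactly $k-1$ descents. *)

theory Defs
  imports
    "HOL-Analysis.Analysis"
    "HOL-Computational_Algebra.Polynomial"
    "HOL-Combinatorics.Permutations"
begin

(* The ring Q[x,y,z] is represented as Q[y][z][x]: the outermost polynomial variable is x,
   the next one is z, and the innermost one is y.  Hence evaluating the two outer variables
   at 1 is the substitution x = z = 1, and its result is an element of Q[y]. *)
type_synonym ring_xyz = "rat poly poly poly"

definition X :: ring_xyz where "X = [:0, 1:]"
definition Z :: ring_xyz where "Z = [:[:0, 1:]:]"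
definition Y :: ring_xyz where "Y = [:[:[:0, 1:]:]:]"

definition const_xyz :: "rat \<Rightarrow> ring_xyz" where
  "const_xyz q = [:[:[:q:]:]:]"

definition at_xz_1 :: "ring_xyz \<Rightarrow> rat poly" where
  "at_xz_1 p = poly (poly p 1) 1"

definition rat_derivation :: "(ring_xyz \<Rightarrow> ring_xyz) \<Rightarrow> bool" where
  "rat_derivation d \<longleftrightarrow>
     (\<forall>u v. d (u + v) = d u + d v) \<and>
     (\<forall>q u. d (const_xyz q * u) = const_xyz q * d u) \<and>
     (\<forall>u v. d (u * v) = d u * v + u * d v)"

definition is_grammar_derivative :: "(ring_xyz \<Rightarrow> ring_xyz) \<Rightarrow> bool" where
  "is_grammar_derivative d \<longleftrightarrow>
     rat_derivation d \<and> d X = X * Y * Z \<and> d Y = Y * Z ^ 2 \<and> d Z = Y ^ 2 * Z"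

definition D :: "ring_xyz \<Rightarrow> ring_xyz" where
  "D = (THE d. is_grammar_derivative d)"

definition theta :: "(real \<Rightarrow> real) \<Rightarrow> real \<Rightarrow> real" where
  "theta f = (\<lambda>t. t * deriv f t)"

definition r :: "real \<Rightarrow> real" where
  "r t = sqrt (1 + t) / sqrt (1 - t)"

(* The defining property of the numbers T(n,k) for a fixed n >= 1; they are extended by 0
   outside 1 <= k <= 2n - 1 so that uniqueness holds. *)
definition is_T_row :: "nat \<Rightarrow> (nat \<Rightarrow> nat) \<Rightarrow> bool" where
  "is_T_row n c \<longleftrightarrow>
     (\<forall>k. c k > 0 \<longleftrightarrow> k \<in> {1..2 * n - 1}) \<and>
     (\<forall>t. -1 < t \<and> t < 1 \<longrightarrow>
        (theta ^^ n) r t =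
          (\<Sum>k = 1..2 * n - 1. real (c k) * t ^ k) /
            ((1 - t) ^ n * (1 + t) ^ (n - 1) * sqrt (1 - t ^ 2)))"

definition T :: "nat \<Rightarrow> nat \<Rightarrow> nat" where
  "T n = (THE c. is_T_row n c)"

definition T_poly :: "nat \<Rightarrow> rat poly" where
  "T_poly n = (\<Sum>k = 1..2 * n - 1. monom (of_nat (T n k)) k)"

definition des :: "nat \<Rightarrow> (nat \<Rightarrow> nat) \<Rightarrow> nat" where
  "des n \<pi> = card {i \<in> {1..<n}. \<pi> i > \<pi> (i + 1)}"

definition eulerian_poly :: "nat \<Rightarrow> rat poly" where
  "eulerian_poly n = (\<Sum>\<pi> | \<pi> permutes {1..n}. monom 1 (des n \<pi> + 1))"

definition eulerian :: "nat \<Rightarrow> nat \<Rightarrow> nat" where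
  "eulerian n k = card {\<pi>. \<pi> permutes {1..n} \<and> des n \<pi> + 1 = k}"

lemma eulerian_poly_conv_eulerian:
  assumes "n \<ge> 1"
  shows "eulerian_poly n = (\<Sum>k = 1..n. monom (of_nat (eulerian n k)) k)"
proof -
  let ?P = "{\<pi>. \<pi> permutes {1..n}}"
  have fin: "finite ?P" by (simp add: finite_permutations)
  have des_le: "des n \<pi> + 1 \<in> {1..n}" for \<pi>
  proof -
    have "des n \<pi> \<le> card {1..<n}" unfolding des_def by (rule card_mono) auto
    then show ?thesis using assms by simp
  qed
  have "eulerian_poly n =
      (\<Sum>k = 1..n. \<Sum>\<pi> | \<pi> \<in> ?P \<and> des n \<pi> + 1 = k. monom (1::rat) (des n \<pi> + 1))"
    unfolding eulerian_poly_def
    by (rule sum.group[symmetric]) (use fin des_le in auto)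
  also have "\<dots> = (\<Sum>k = 1..n. monom (of_nat (eulerian n k)) k)"
  proof (rule sum.cong[OF refl])
    fix k
    have "(\<Sum>\<pi> | \<pi> \<in> ?P \<and> des n \<pi> + 1 = k. monom (1::rat) (des n \<pi> + 1)) =
        (\<Sum>\<pi> | \<pi> \<in> ?P \<and> des n \<pi> + 1 = k. monom (1::rat) k)"
      by (rule sum.cong) auto
    also have "\<dots> = monom (of_nat (eulerian n k)) k"
      by (simp add: eulerian_def of_nat_monom mult_monom)
    finally show "(\<Sum>\<pi> | \<pi> \<in> ?P \<and> des n \<pi> + 1 = k. monom (1::rat) (des n \<pi> + 1)) =
        monom (of_nat (eulerian n k)) k" .
  qed
  finally show ?thesis .
qed

lemma map_poly_add_gen:
  assumes "\<And>a b. f (a + b) = f a + f b" "f 0 = 0"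
  shows "map_poly f (p + q) = map_poly f p + map_poly f q"
  by (rule poly_eqI) (simp add: coeff_map_poly assms)

lemma map_poly_Leibniz:
  fixes f :: "'a::comm_ring_1 \<Rightarrow> 'a"
  assumes add: "\<And>a b. f (a + b) = f a + f b"
    and zero: "f 0 = 0"
    and mul: "\<And>a b. f (a * b) = f a * b + a * f b"
  shows "map_poly f (p * q) = map_poly f p * q + p * map_poly f q"
proof -
  have fsum: "f (sum g A) = (\<Sum>a\<in>A. f (g a))" for g :: "nat \<Rightarrow> 'a" and A
    by (induction A rule: infinite_finite_induct) (simp_all add: add zero)
  show ?thesis
    by (rule poly_eqI) (simp add: coeff_map_poly zero coeff_mult fsum mul sum.distrib)
qed

lemma ex1_grammar_derivative: "\<exists>!d. is_grammar_derivative d"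
proof (rule ex_ex1I)
  define dz :: "rat poly poly poly \<Rightarrow> rat poly poly poly" where "dz = map_poly pderiv"
  define dy' :: "rat poly poly \<Rightarrow> rat poly poly" where "dy' = map_poly pderiv"
  define dy :: "rat poly poly poly \<Rightarrow> rat poly poly poly" where "dy = map_poly dy'"
  have dy'_0: "dy' 0 = 0" by (simp add: dy'_def)
  have dy'_add: "dy' (u + v) = dy' u + dy' v" for u v
    unfolding dy'_def by (rule map_poly_add_gen) (simp_all add: pderiv_add)
  have dy'_mult: "dy' (u * v) = dy' u * v + u * dy' v" for u v
    unfolding dy'_def
    by (rule map_poly_Leibniz) (simp_all add: pderiv_add pderiv_mult algebra_simps)
  have dy_add: "dy (u + v) = dy u + dy v" for u v
    unfolding dy_def by (rule map_poly_add_gen) (simp_all add: dy'_add dy'_0)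
  have dy_mult: "dy (u * v) = dy u * v + u * dy v" for u v
    unfolding dy_def by (rule map_poly_Leibniz) (simp_all add: dy'_add dy'_0 dy'_mult)
  have dz_add: "dz (u + v) = dz u + dz v" for u v
    unfolding dz_def by (rule map_poly_add_gen) (simp_all add: pderiv_add)
  have dz_mult: "dz (u * v) = dz u * v + u * dz v" for u v
    unfolding dz_def
    by (rule map_poly_Leibniz) (simp_all add: pderiv_add pderiv_mult algebra_simps)
  have const: "pderiv (const_xyz q) = 0" "dy (const_xyz q) = 0" "dz (const_xyz q) = 0" for q
    by (simp_all add: const_xyz_def dy_def dz_def dy'_def map_poly_pCons pderiv_pCons)
  have vars: "pderiv X = 1" "dy X = 0" "dz X = 0" "pderiv Y = 0" "dy Y = 1" "dz Y = 0"
    "pderiv Z = 0" "dy Z = 0" "dz Z = 1"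
    by (simp_all add: X_def Y_def Z_def dy_def dz_def dy'_def map_poly_pCons pderiv_pCons one_pCons)
  define d where "d = (\<lambda>u. X * Y * Z * pderiv u + Y * Z ^ 2 * dy u + Y ^ 2 * Z * dz u)"
  have "is_grammar_derivative d"
    unfolding is_grammar_derivative_def rat_derivation_def d_def
    by (simp add: pderiv_add pderiv_mult dy_add dy_mult dz_add dz_mult const vars)
       (simp add: algebra_simps)
  then show "\<exists>d. is_grammar_derivative d" by (rule exI[of _ d])
next
  fix d e
  assume d: "is_grammar_derivative d" and e: "is_grammar_derivative e"
  have add: "d (u + v) = d u + d v" "e (u + v) = e u + e v"
    and mul: "d (u * v) = d u * v + u * d v" "e (u * v) = e u * v + u * e v"
    and sc: "d (const_xyz q * u) = const_xyz q * d u" "e (const_xyz q * u) = const_xyz q * e u"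
    and gen: "d X = e X" "d Y = e Y" "d Z = e Z" for u v q
    using d e unfolding is_grammar_derivative_def rat_derivation_def by metis+
  have one: "d 1 = 0" "e 1 = 0" using mul(1)[of 1 1] mul(2)[of 1 1] by simp_all
  have zero: "d 0 = 0" "e 0 = 0" using add(1)[of 0 0] add(2)[of 0 0] by simp_all
  have c0: "d (const_xyz q) = e (const_xyz q)" for q
    using sc(1)[of q 1] sc(2)[of q 1] one by simp
  have c1: "d [:[:p:]:] = e [:[:p:]:]" for p
  proof (induction p)
    case (pCons a p)
    have "[:[:pCons a p:]:] = const_xyz a + Y * [:[:p:]:]"
      by (simp add: const_xyz_def Y_def)
    then show ?case using pCons by (simp only: add mul c0 gen)
  qed (simp add: zero)
  have c2: "d [:p:] = e [:p:]" for p
  proof (induction p)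
    case (pCons a p)
    have "[:pCons a p:] = [:[:a:]:] + Z * [:p:]"
      by (simp add: Z_def)
    then show ?case using pCons by (simp only: add mul c1 gen)
  qed (simp add: zero)
  have "d p = e p" for p
  proof (induction p)
    case (pCons a p)
    have "pCons a p = [:a:] + X * p"
      by (simp add: X_def)
    then show ?case using pCons by (simp only: add mul c2 gen)
  qed (simp add: zero)
  then show "d = e" by (rule ext)
qed

lemma is_grammar_derivative_D: "is_grammar_derivative D"
  unfolding D_def by (rule theI'[OF ex1_grammar_derivative])

lemma one_minus_square_nonzero:
  fixes t :: real
  assumes "-1 < t" "t < 1"
  shows "1 - t ^ 2 \<noteq> 0"
  using assms abs_square_less_1[of t] by auto

lemma r_times_sqrt:
  fixes t :: real
  assumes "-1 < t" "t < 1"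
  shows "1 / sqrt (1 - t ^ 2) = r t / (1 + t)"
proof -
  have eq: "sqrt (1 - t ^ 2) = sqrt (1 + t) * sqrt (1 - t)"
    by (simp add: real_sqrt_mult[symmetric] power2_eq_square algebra_simps)
  have "sqrt (1 + t) > 0" "sqrt (1 - t) > 0" using assms by simp_all
  moreover have "1 + t = sqrt (1 + t) * sqrt (1 + t)" using assms by simp
  moreover have "1 / (a * b) = a / b / (a * a)" if "a > 0" "b > 0" for a b :: real
    using that by (simp add: field_simps)
  ultimately show ?thesis unfolding eq r_def by metis
qed

lemma T_denominator:
  fixes t :: real
  assumes "n \<ge> 1" "-1 < t" "t < 1"
  shows "N / ((1 - t) ^ n * (1 + t) ^ (n - 1) * sqrt (1 - t ^ 2)) = N * r t / (1 - t ^ 2) ^ n"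
proof -
  obtain m where n: "n = Suc m" using assms(1) by (cases n) auto
  have fac: "(1 - t ^ 2) ^ n = (1 - t) ^ n * (1 + t) ^ n"
    by (simp add: power_mult_distrib[symmetric] power2_eq_square algebra_simps)
  have "N / ((1 - t) ^ n * (1 + t) ^ (n - 1) * sqrt (1 - t ^ 2)) =
      N / ((1 - t) ^ n * (1 + t) ^ (n - 1)) * (1 / sqrt (1 - t ^ 2))"
    by simp
  also have "\<dots> = N * r t / ((1 - t) ^ n * ((1 + t) ^ (n - 1) * (1 + t)))"
    unfolding r_times_sqrt[OF assms(2,3)] by simp
  also have "(1 + t) ^ (n - 1) * (1 + t) = (1 + t) ^ n"
    unfolding n by simp
  finally show ?thesis unfolding fac .
qed

lemma has_real_derivative_r:
  assumes "-1 < t" "t < 1"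
  shows "(r has_real_derivative r t / (1 - t ^ 2)) (at t)"
proof -
  have pos: "sqrt (1 + t) > 0" "sqrt (1 - t) > 0" using assms by simp_all
  have sq: "sqrt (1 + t) ^ 2 = 1 + t" "sqrt (1 - t) ^ 2 = 1 - t" using assms by simp_all
  have ne: "1 - t ^ 2 \<noteq> 0"
    by (rule one_minus_square_nonzero[OF assms])
  have "(r has_real_derivative
      (inverse (sqrt (1 + t)) / 2 * sqrt (1 - t) - sqrt (1 + t) * (- (inverse (sqrt (1 - t)) / 2))) /
        (sqrt (1 - t) * sqrt (1 - t))) (at t)"
    unfolding r_def[abs_def] using assms pos by (auto intro!: derivative_eq_intros)
  moreover have key: "(inverse a / 2 * b - a * (- (inverse b / 2))) / (b * b) = a / b / (1 - t ^ 2)"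
    if "a > 0" "b > 0" "a ^ 2 = 1 + t" "b ^ 2 = 1 - t" for a b :: real
  proof -
    have ab: "1 - t ^ 2 = a ^ 2 * b ^ 2"
      unfolding that(3,4) by (simp add: power2_eq_square algebra_simps)
    have "inverse a / 2 * b - a * (- (inverse b / 2)) = (b ^ 2 + a ^ 2) / (2 * a * b)"
      using that(1,2) by (simp add: field_simps power2_eq_square)
    also have "b ^ 2 + a ^ 2 = 2" using that by simp
    finally show ?thesis unfolding ab using that(1,2) by (simp add: divide_simps power2_eq_square)
  qed
  ultimately show ?thesis unfolding key[OF pos sq] by (simp only: r_def)
qed

lemma ex_T_row:
  assumes "n \<ge> 1"
  shows "\<exists>c. is_T_row n c"
proof -
  define S :: "nat \<Rightarrow> (nat \<Rightarrow> nat) \<Rightarrow> real poly \<Rightarrow> bool" where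
    "S = (\<lambda>n c p. (\<forall>k. c k > 0 \<longleftrightarrow> k \<in> {1..2 * n - 1}) \<and> (\<forall>k. coeff p k = real (c k)) \<and>
       (\<forall>t. -1 < t \<and> t < 1 \<longrightarrow> (theta ^^ n) r t = poly p t * r t / (1 - t ^ 2) ^ n))"
  have "\<exists>c p. S n c p" using assms
  proof (induction n rule: nat_induct_at_least)
    case base
    have "S 1 (\<lambda>k. if k = 1 then 1 else 0) [:0, 1:]"
      unfolding S_def
      by (auto simp: theta_def DERIV_imp_deriv[OF has_real_derivative_r] coeff_pCons split: nat.splits)
    then show ?case by blast
  next
    case (Suc n)
    then obtain c p where cp: "S n c p" by blast
    have n1: "n \<ge> 1" using Suc.hyps by simp
    have supp: "c k > 0 \<longleftrightarrow> k \<in> {1..2 * n - 1}" and coef: "coeff p k = real (c k)" for k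
      using cp unfolding S_def by blast+
    define c' where "c' = (\<lambda>k. k * c k + (if k \<ge> 1 then c (k - 1) else 0) +
      (if k \<ge> 2 then (2 * n + 2 - k) * c (k - 2) else 0))"
    define p' where "p' = pCons 0 (pderiv p) - pCons 0 (pCons 0 (pCons 0 (pderiv p))) + pCons 0 p +
      smult (2 * real n) (pCons 0 (pCons 0 p))"
    have vanish: "c k = 0" if "k > 2 * n - 1" for k using supp[of k] that by auto
    have supp': "c' k > 0 \<longleftrightarrow> k \<in> {1..2 * Suc n - 1}" for k
    proof -
      consider "k = 0" | "k = 1" | "2 \<le> k" "k \<le> 2 * n + 1" | "k > 2 * n + 1" by linarith
      then show ?thesis
      proof cases
        case 3
        have "c (k - 2) > 0 \<or> c (k - 1) > 0"
          unfolding supp atLeastAtMost_iff using 3 n1 by linarith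
        then show ?thesis using 3 by (auto simp: c'_def)
      qed (use n1 supp[of 1] vanish in \<open>auto simp: c'_def\<close>)
    qed
    have coef': "coeff p' k = real (c' k)" for k
    proof -
      consider "k = 0" | "k = 1" | j where "k = Suc (Suc j)"
        by (metis One_nat_def nat.exhaust)
      then show ?thesis
      proof cases
        case 3
        define m where "m = 2 * n + 2 - k"
        have m: "real m * real (c j) = (2 * real n - real j) * real (c j)"
        proof (cases "j \<le> 2 * n - 1")
          case True
          then show ?thesis using 3 by (simp add: m_def of_nat_diff)
        qed (use vanish in auto)
        have "c' k = k * c k + c (Suc j) + m * c j"
          using 3 by (simp add: c'_def m_def)
        then have "real (c' k) = real k * real (c k) + real (c (Suc j)) + real m * real (c j)"
          by simp
        also have "\<dots> = coeff p' k"
          unfolding m 3 p'_def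
          by (cases j) (simp_all add: coeff_pderiv coef algebra_simps)
        finally show ?thesis ..
      qed (simp_all add: p'_def c'_def coeff_pderiv coef)
    qed
    have form: "(theta ^^ Suc n) r t = poly p' t * r t / (1 - t ^ 2) ^ Suc n"
      if t: "-1 < t" "t < 1" for t
    proof -
      define w where "w = 1 - t ^ 2"
      have w: "w \<noteq> 0" unfolding w_def
        by (rule one_minus_square_nonzero[OF t])
      obtain m where m: "n = Suc m" using n1 by (cases n) auto
      have "((\<lambda>t. poly p t * r t / (1 - t ^ 2) ^ n) has_real_derivative
          ((poly (pderiv p) t * r t + r t / w * poly p t) * w ^ n -
            poly p t * r t * (real n * (w ^ m * (- (2 * t))))) / (w ^ n * w ^ n)) (at t)"
      proof -
        have "((\<lambda>t. (1 - t ^ 2) ^ n) has_real_derivative real n * (w ^ m * (- (2 * t)))) (at t)"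
          unfolding w_def by (rule derivative_eq_intros refl)+ (simp add: m)
        from DERIV_divide[OF DERIV_mult[OF poly_DERIV[of p t] has_real_derivative_r[OF t]] this]
        show ?thesis using w by (simp add: w_def)
      qed
      moreover have "eventually (\<lambda>s. (theta ^^ n) r s = poly p s * r s / (1 - s ^ 2) ^ n) (nhds t)"
      proof -
        have "eventually (\<lambda>s. s \<in> {-1<..<1}) (nhds t)"
          using t by (intro eventually_nhds_in_open) auto
        then show ?thesis by eventually_elim (use cp in \<open>auto simp: S_def\<close>)
      qed
      ultimately have "((theta ^^ n) r has_real_derivative
          ((poly (pderiv p) t * r t + r t / w * poly p t) * w ^ n -
            poly p t * r t * (real n * (w ^ m * (- (2 * t))))) / (w ^ n * w ^ n)) (at t)"
        by (subst DERIV_cong_ev[OF refl _ refl])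
      then have "(theta ^^ Suc n) r t = t *
          (((poly (pderiv p) t * r t + r t / w * poly p t) * w ^ n -
            poly p t * r t * (real n * (w ^ m * (- (2 * t))))) / (w ^ n * w ^ n))"
        by (simp add: theta_def DERIV_imp_deriv)
      also have "\<dots> = t * (poly (pderiv p) t * w + poly p t + 2 * real n * t * poly p t) * r t /
          w ^ Suc n"
        using w unfolding m by (simp add: field_simps)
      also have "t * (poly (pderiv p) t * w + poly p t + 2 * real n * t * poly p t) = poly p' t"
        unfolding p'_def w_def by (simp add: algebra_simps power2_eq_square)
      finally show ?thesis unfolding w_def .
    qed
    have "S (Suc n) c' p'" unfolding S_def using supp' coef' form by blast
    then show ?case by blast
  qed
  then obtain c p where cp: "S n c p" by blast
  have "is_T_row n c"
    unfolding is_T_row_def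
  proof (intro conjI allI impI)
    show "c k > 0 \<longleftrightarrow> k \<in> {1..2 * n - 1}" for k using cp unfolding S_def by blast
    fix t :: real assume t: "-1 < t \<and> t < 1"
    have van: "c k = 0" if "k \<notin> {1..2 * n - 1}" for k using cp that unfolding S_def by blast
    have coef: "coeff p k = real (c k)" for k using cp unfolding S_def by blast
    have deg: "degree p \<le> 2 * n - 1"
      by (rule degree_le) (use coef van in auto)
    have "poly p t = (\<Sum>k\<le>2 * n - 1. real (c k) * t ^ k)"
      by (subst poly_as_sum_of_monoms'[OF deg, symmetric]) (simp add: poly_sum poly_monom coef)
    also have "\<dots> = (\<Sum>k = 1..2 * n - 1. real (c k) * t ^ k)"
      by (rule sum.mono_neutral_right) (use van in auto)
    finally have p: "poly p t = (\<Sum>k = 1..2 * n - 1. real (c k) * t ^ k)" .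
    have "(theta ^^ n) r t = poly p t * r t / (1 - t ^ 2) ^ n"
      using cp t unfolding S_def by blast
    then show "(theta ^^ n) r t = (\<Sum>k = 1..2 * n - 1. real (c k) * t ^ k) /
        ((1 - t) ^ n * (1 + t) ^ (n - 1) * sqrt (1 - t ^ 2))"
      using T_denominator[OF assms, of t] t unfolding p by simp
  qed
  then show ?thesis by blast
qed

lemma is_T_row_unique:
  assumes "n \<ge> 1" and c: "is_T_row n c" and d: "is_T_row n d"
  shows "c = d"
proof -
  define p q :: "real poly" where
    "p = (\<Sum>k = 1..2 * n - 1. monom (real (c k)) k)" and
    "q = (\<Sum>k = 1..2 * n - 1. monom (real (d k)) k)"
  have "poly p t = poly q t" if t: "t \<in> {-1<..<1}" for t
  proof -
    have nz: "(1 - t) ^ n * (1 + t) ^ (n - 1) * sqrt (1 - t ^ 2) \<noteq> 0"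
      using t abs_square_less_1[of t] by auto
    have "poly p t / ((1 - t) ^ n * (1 + t) ^ (n - 1) * sqrt (1 - t ^ 2)) =
        poly q t / ((1 - t) ^ n * (1 + t) ^ (n - 1) * sqrt (1 - t ^ 2))"
      using c d t by (simp add: is_T_row_def p_def q_def poly_sum poly_monom)
    then show ?thesis using nz by (metis divide_cancel_right)
  qed
  then have "{-1<..<1} \<subseteq> {t. poly (p - q) t = 0}" by auto
  moreover have "infinite {-1<..<1::real}" by (simp add: infinite_Ioo)
  ultimately have "p - q = 0" using poly_roots_finite[of "p - q"] finite_subset by blast
  then have eq: "coeff p k = coeff q k" for k by simp
  have "c k = d k" for k
  proof (cases "k \<in> {1..2 * n - 1}")
    case True
    then show ?thesis using eq[of k] by (simp add: p_def q_def coeff_sum)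
  next
    case False
    then show ?thesis using c d by (metis is_T_row_def neq0_conv)
  qed
  then show ?thesis by (rule ext)
qed

lemma is_T_row_T: "n \<ge> 1 \<Longrightarrow> is_T_row n (T n)"
  unfolding T_def using ex_T_row is_T_row_unique by (metis theI')

end

theory Submission
  imports Defs
begin

text \<open>
  The first formula holds because the grammar is modelled by the operator \<open>t d/dt\<close>. The functions
  \<open>y = t / sqrt (1 - t^2)\<close>, \<open>z = 1 / sqrt (1 - t^2)\<close> and \<open>x = r t\<close> satisfy the three rules of the
  grammar when \<open>D\<close> is read as \<open>t d/dt\<close>, and \<open>y^k z^(2n-k) = t^k / (1 - t^2)^n\<close>. Hence the
  expansion of \<open>D^n(x)\<close> and that of the \<open>n\<close>-th iterate of \<open>t d/dt\<close> on \<open>r\<close> obey the same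
  recurrence in \<open>n\<close>. On both sides a monomial \<open>x y^k z^m\<close> with \<open>k + m = 2n\<close> acquires the factor
  \<open>y z + k z^2 + m y^2\<close>. The lemma \<open>sum_T_step\<close> turns this factor into a recurrence for
  coefficients, once for every commutative semiring: it is used over the reals with \<open>y = t\<close>,
  \<open>z = 1\<close> to obtain \<open>T_Suc\<close>, where uniqueness of the row \<open>T n\<close> identifies the coefficients, and
  over the polynomial ring to obtain \<open>D_iterate_X\<close>.

  For the second formula, let \<open>A_n\<close> be the sum of \<open>y^(d+1) z^(n-d)\<close> over all permutations of
  \<open>{1..n}\<close>, with \<open>d\<close> the number of descents. Since \<open>D(x^2) = 2 x^2 y z\<close> and
  \<open>D(y + z) = y z (y + z)\<close>, applying \<open>D\<close> to \<open>x^2 (y + z)^(n-1) A_n\<close> multiplies a monomial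
  \<open>y^k z^m\<close> of \<open>A_n\<close>, where \<open>k + m = n + 1\<close>, by
  \<open>(k + m) y z + k z^2 + m y^2 = (y + z) (k z + m y)\<close>. The factor \<open>y + z\<close> raises the power by one,
  and \<open>k z + m y\<close> is the effect of inserting the letter \<open>n + 1\<close> into a permutation with \<open>k - 1\<close>
  descents: of the \<open>n + 1\<close> places, \<open>k\<close> preserve the number of descents and the other \<open>m\<close> raise it
  by one (\<open>sum_des_Suc\<close>).
\<close>

section \<open>The grammar derivation\<close>

lemma D_add: "D (u + v) = D u + D v"
  and D_mult: "D (u * v) = D u * v + u * D v"
  and D_X: "D X = X * Y * Z"
  and D_Y: "D Y = Y * Z ^ 2"
  and D_Z: "D Z = Y ^ 2 * Z"
  using is_grammar_derivative_D
  unfolding is_grammar_derivative_def rat_derivation_def by blast+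

lemma D_0: "D 0 = 0"
  using D_add[of 0 0] by simp

lemma D_of_nat: "D (of_nat m) = 0"
  using D_mult[of 1 1] by (induction m) (simp_all add: D_0 D_add)

lemma D_sum: "D (sum f A) = (\<Sum>a\<in>A. D (f a))"
  by (induction A rule: infinite_finite_induct) (simp_all add: D_0 D_add)

lemma D_of_nat_mult: "D (of_nat m * u) = of_nat m * D u"
  by (simp add: D_mult D_of_nat)

lemma D_power: "D u = u * e \<Longrightarrow> D (u ^ k) = of_nat k * (u ^ k * e)"
  using D_of_nat[of 1] by (induction k) (simp_all add: D_mult algebra_simps)

lemma D_Y_Z_monomial:
  "D (Y ^ k * Z ^ m) = Y ^ k * Z ^ m * (of_nat k * Z ^ 2 + of_nat m * Y ^ 2)"
proof -
  have "D (Y ^ k) = of_nat k * (Y ^ k * Z ^ 2)"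
    by (rule D_power) (rule D_Y)
  moreover have "D (Z ^ m) = of_nat m * (Z ^ m * Y ^ 2)"
    by (rule D_power) (simp add: D_Z mult.commute)
  ultimately show ?thesis by (simp add: D_mult algebra_simps)
qed

section \<open>The recurrence of the numbers T(n,k)\<close>

text \<open>
  The passage from one row of the numbers \<open>T(n,k)\<close> to the next. The truncated difference
  \<open>2 * n + 2 - k\<close> is the exponent of \<open>z\<close> in the monomial of degree \<open>2 * n\<close> that contains \<open>y^(k-2)\<close>.
\<close>

definition T_step :: "nat \<Rightarrow> (nat \<Rightarrow> nat) \<Rightarrow> nat \<Rightarrow> nat" where
  "T_step n c k = k * c k + (if k \<ge> 1 then c (k - 1) else 0) +
     (if k \<ge> 2 then (2 * n + 2 - k) * c (k - 2) else 0)"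

text \<open>
  The factor \<open>y z + k z^2 + m y^2\<close> raises the exponent of \<open>y\<close> by one, zero or two, and each of these
  three shifts contributes one of the terms of \<open>T_step\<close>.
\<close>

lemma sum_T_step:
  fixes y z :: "'a :: comm_semiring_1"
  assumes supp: "{k. c k \<noteq> 0} \<subseteq> {1..2 * n - 1}"
  shows "(\<Sum>k = 1..2 * n - 1. of_nat (c k) *
            (y ^ k * z ^ (2 * n - k) * (y * z + of_nat k * z ^ 2 + of_nat (2 * n - k) * y ^ 2)))
       = (\<Sum>k = 1..2 * Suc n - 1. of_nat (T_step n c k) * y ^ k * z ^ (2 * Suc n - k))"
proof -
  have van: "c k = 0" if "k \<notin> {1..2 * n - 1}" for k
    using supp that by blast
  define g where "g k = y ^ k * z ^ (2 * n + 2 - k)" for k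
  have "(\<Sum>k = 1..2 * n - 1. of_nat (c k) *
            (y ^ k * z ^ (2 * n - k) * (y * z + of_nat k * z ^ 2 + of_nat (2 * n - k) * y ^ 2)))
      = (\<Sum>k\<le>2 * n. of_nat (c k) *
            (y ^ k * z ^ (2 * n - k) * (y * z + of_nat k * z ^ 2 + of_nat (2 * n - k) * y ^ 2)))"
    by (rule sum.mono_neutral_left) (use van in auto)
  also have "\<dots> = (\<Sum>k\<le>2 * n. of_nat (c k) * g (Suc k) + of_nat (k * c k) * g k
      + of_nat ((2 * n - k) * c k) * g (Suc (Suc k)))"
  proof (rule sum.cong[OF refl])
    fix k assume "k \<in> {..2 * n}"
    then have "2 * n + 2 - k = Suc (Suc (2 * n - k))" "2 * n + 2 - Suc k = Suc (2 * n - k)"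
      "2 * n + 2 - Suc (Suc k) = 2 * n - k" by auto
    then have "g k = y ^ k * (z ^ 2 * z ^ (2 * n - k))"
      "g (Suc k) = y * y ^ k * (z * z ^ (2 * n - k))"
      "g (Suc (Suc k)) = y ^ 2 * y ^ k * z ^ (2 * n - k)"
      by (simp_all only: g_def power_Suc power2_eq_square mult.assoc)
    then show "of_nat (c k) *
            (y ^ k * z ^ (2 * n - k) * (y * z + of_nat k * z ^ 2 + of_nat (2 * n - k) * y ^ 2)) =
        of_nat (c k) * g (Suc k) + of_nat (k * c k) * g k
          + of_nat ((2 * n - k) * c k) * g (Suc (Suc k))"
      by (simp add: distrib_left mult_ac)
  qed
  also have "\<dots> = (\<Sum>k\<le>Suc (Suc (2 * n)). of_nat (k * c k) * g k)
      + (\<Sum>k\<le>Suc (Suc (2 * n)). of_nat (if k \<ge> 1 then c (k - 1) else 0) * g k)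
      + (\<Sum>k\<le>Suc (Suc (2 * n)). of_nat (if k \<ge> 2 then (2 * n + 2 - k) * c (k - 2) else 0) * g k)"
  proof -
    have "(\<Sum>k\<le>Suc (Suc (2 * n)). of_nat (k * c k) * g k) = (\<Sum>k\<le>2 * n. of_nat (k * c k) * g k)"
      using van by simp
    moreover have "(\<Sum>k\<le>Suc (Suc (2 * n)). of_nat (if k \<ge> 1 then c (k - 1) else 0) * g k) =
        (\<Sum>k\<le>2 * n. of_nat (c k) * g (Suc k))"
      by (subst sum.atMost_Suc_shift) (use van in simp)
    moreover have "(\<Sum>k\<le>Suc (Suc (2 * n)).
          of_nat (if k \<ge> 2 then (2 * n + 2 - k) * c (k - 2) else 0) * g k) =
        (\<Sum>k\<le>2 * n. of_nat ((2 * n - k) * c k) * g (Suc (Suc k)))"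
      by (subst sum.atMost_Suc_shift, subst sum.atMost_Suc_shift) simp
    ultimately show ?thesis by (simp only: sum.distrib) (simp only: ac_simps)
  qed
  also have "\<dots> = (\<Sum>k\<le>Suc (Suc (2 * n)). of_nat (T_step n c k) * g k)"
    by (simp only: T_step_def of_nat_add distrib_right sum.distrib)
  also have "\<dots> = (\<Sum>k = 1..2 * Suc n - 1. of_nat (T_step n c k) * g k)"
  proof (rule sum.mono_neutral_right)
    show "\<forall>k\<in>{..Suc (Suc (2 * n))} - {1..2 * Suc n - 1}. of_nat (T_step n c k) * g k = 0"
    proof
      fix k assume "k \<in> {..Suc (Suc (2 * n))} - {1..2 * Suc n - 1}"
      then have "k = 0 \<or> k = Suc (Suc (2 * n))" by auto
      then show "of_nat (T_step n c k) * g k = 0" using van by (auto simp: T_step_def)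
    qed
  qed auto
  finally show ?thesis by (simp add: g_def mult.assoc)
qed

lemma T_step_pos_iff:
  assumes supp: "\<And>k. c k > 0 \<longleftrightarrow> k \<in> {1..2 * n - 1}" and n: "n \<ge> 1"
  shows "T_step n c k > 0 \<longleftrightarrow> k \<in> {1..2 * Suc n - 1}"
proof -
  have van: "c k = 0" if "k > 2 * n - 1" for k using supp[of k] that by auto
  consider "k = 0" | "k = 1" | "2 \<le> k" "k \<le> 2 * n + 1" | "k > 2 * n + 1" by linarith
  then show ?thesis
  proof cases
    case 3
    have "c (k - 2) > 0 \<or> c (k - 1) > 0"
      unfolding supp atLeastAtMost_iff using 3 n by linarith
    then show ?thesis using 3 by (auto simp: T_step_def)
  qed (use n supp[of 1] van in \<open>auto simp: T_step_def\<close>)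
qed

text \<open>
  The grammar acting on \<open>x y^k z^(2n-k)\<close>, transported to functions of \<open>t\<close>. The derivative itself
  contains \<open>t^(k-1)\<close>, which needs a case distinction on \<open>k\<close>; multiplication by \<open>t\<close> removes it, and
  only this product enters \<open>theta\<close>.
\<close>

lemma has_real_derivative_r_monomial:
  assumes "-1 < t" "t < 1"
  shows "\<exists>d. ((\<lambda>t. t ^ k * r t / (1 - t ^ 2) ^ n) has_real_derivative d) (at t) \<and>
    t * d = t ^ k * (t + real k + (2 * real n - real k) * t ^ 2) * r t / (1 - t ^ 2) ^ Suc n"
proof -
  define w where "w = 1 - t ^ 2"
  have w: "w \<noteq> 0" unfolding w_def by (rule one_minus_square_nonzero[OF assms])
  define a where "a = real k * t ^ (k - 1)"
  define b where "b = - (real n * w ^ (n - 1) * (2 * t))"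
  have ta: "t * a = real k * t ^ k" by (cases k) (simp_all add: a_def)
  have wb: "w * b = - (real n * w ^ n * (2 * t))" by (cases n) (simp_all add: b_def)
  have "((\<lambda>t. t ^ k) has_real_derivative a) (at t)"
    unfolding a_def by (rule derivative_eq_intros refl)+ simp
  moreover have "((\<lambda>t. (1 - t ^ 2) ^ n) has_real_derivative b) (at t)"
    unfolding b_def w_def by (rule derivative_eq_intros refl)+ simp
  ultimately have "((\<lambda>t. t ^ k * r t / (1 - t ^ 2) ^ n) has_real_derivative
      ((a * r t + r t / w * t ^ k) * w ^ n - t ^ k * r t * b) / (w ^ n * w ^ n)) (at t)"
    using DERIV_divide[OF DERIV_mult[OF _ has_real_derivative_r[OF assms]],
        of "\<lambda>t. t ^ k" a "\<lambda>t. (1 - t ^ 2) ^ n" b] w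
    by (simp add: w_def)
  moreover have "t * (((a * r t + r t / w * t ^ k) * w ^ n - t ^ k * r t * b) / (w ^ n * w ^ n)) =
     t ^ k * (t + real k + (2 * real n - real k) * t ^ 2) * r t / w ^ Suc n"
  proof -
    have "t * (((a * r t + r t / w * t ^ k) * w ^ n - t ^ k * r t * b) / (w ^ n * w ^ n)) =
      (((t * a) * w + t * t ^ k) * w ^ n - t * t ^ k * (w * b)) * r t / (w ^ n * w ^ n * w)"
      using w by (simp add: field_simps)
    also have "\<dots> = t ^ k * (real k * w + t + 2 * real n * t ^ 2) * r t * w ^ n / (w ^ n * w ^ n * w)"
      unfolding ta wb by (simp add: algebra_simps power2_eq_square)
    also have "\<dots> = t ^ k * (real k * w + t + 2 * real n * t ^ 2) * r t / w ^ Suc n"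
      using w by (simp add: mult_ac)
    also have "real k * w + t + 2 * real n * t ^ 2 = t + real k + (2 * real n - real k) * t ^ 2"
      by (simp add: w_def algebra_simps)
    finally show ?thesis .
  qed
  ultimately show ?thesis unfolding w_def by blast
qed

text \<open>
  Applying \<open>theta\<close> to the defining expansion of \<open>T n\<close> gives an expansion of the required shape with
  coefficients \<open>T_step n (T n)\<close>; such an expansion is unique.
\<close>

lemma T_Suc:
  assumes n: "n \<ge> 1"
  shows "T (Suc n) = T_step n (T n)"
proof (rule is_T_row_unique[OF _ is_T_row_T])
  have row: "is_T_row n (T n)" by (rule is_T_row_T[OF n])
  have supp: "T n k > 0 \<longleftrightarrow> k \<in> {1..2 * n - 1}" for k
    using row unfolding is_T_row_def by blast
  have T_support: "{k. T n k \<noteq> 0} \<subseteq> {1..2 * n - 1}"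
    using supp by blast
  have form: "(theta ^^ n) r t = (\<Sum>k = 1..2 * n - 1. real (T n k) * (t ^ k * r t / (1 - t ^ 2) ^ n))"
    if "-1 < t" "t < 1" for t
    using row that T_denominator[OF n that]
    unfolding is_T_row_def
    by (simp add: sum_distrib_right sum_divide_distrib mult.assoc)
  show "is_T_row (Suc n) (T_step n (T n))"
    unfolding is_T_row_def
  proof (intro conjI allI impI)
    show "T_step n (T n) k > 0 \<longleftrightarrow> k \<in> {1..2 * Suc n - 1}" for k
      by (rule T_step_pos_iff[OF supp n])
    fix t :: real assume "-1 < t \<and> t < 1"
    then have t: "-1 < t" "t < 1" by auto
    obtain d where d: "\<And>k. ((\<lambda>t. t ^ k * r t / (1 - t ^ 2) ^ n) has_real_derivative d k) (at t)"
      "\<And>k. t * d k = t ^ k * (t + real k + (2 * real n - real k) * t ^ 2) * r t / (1 - t ^ 2) ^ Suc n"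
      using has_real_derivative_r_monomial[OF t, of _ n] by metis
    \<comment> \<open>The expansion holds only inside \<open>(-1, 1)\<close>, so the derivative at \<open>t\<close> is taken on a
      neighbourhood contained in that interval.\<close>
    have "((\<lambda>t. \<Sum>k = 1..2 * n - 1. real (T n k) * (t ^ k * r t / (1 - t ^ 2) ^ n))
        has_real_derivative (\<Sum>k = 1..2 * n - 1. real (T n k) * d k)) (at t)"
      by (intro DERIV_sum DERIV_cmult d)
    moreover have "eventually (\<lambda>s. (theta ^^ n) r s =
        (\<Sum>k = 1..2 * n - 1. real (T n k) * (s ^ k * r s / (1 - s ^ 2) ^ n))) (nhds t)"
    proof -
      have "eventually (\<lambda>s. s \<in> {-1<..<1}) (nhds t)"
        using t by (intro eventually_nhds_in_open) auto
      then show ?thesis by eventually_elim (rule form, auto)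
    qed
    ultimately have "((theta ^^ n) r has_real_derivative
        (\<Sum>k = 1..2 * n - 1. real (T n k) * d k)) (at t)"
      by (subst DERIV_cong_ev[OF refl _ refl])
    then have "(theta ^^ Suc n) r t = (\<Sum>k = 1..2 * n - 1. real (T n k) * (t * d k))"
      by (simp add: theta_def DERIV_imp_deriv sum_distrib_left mult_ac)
    \<comment> \<open>The powers of \<open>1\<close> make the sum an instance of the homogeneous identity at \<open>y = t\<close>,
      \<open>z = 1\<close>.\<close>
    also have "\<dots> = (\<Sum>k = 1..2 * n - 1. real (T n k) *
        (t ^ k * 1 ^ (2 * n - k) * (t * 1 + real k * 1 ^ 2 + real (2 * n - k) * t ^ 2)))
        * r t / (1 - t ^ 2) ^ Suc n"
      unfolding d(2) sum_distrib_right sum_divide_distrib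
      by (rule sum.cong) (auto simp: of_nat_diff)
    also have "\<dots> = (\<Sum>k = 1..2 * Suc n - 1. real (T_step n (T n) k) * t ^ k)
        * r t / (1 - t ^ 2) ^ Suc n"
      by (subst sum_T_step[OF T_support]) simp
    finally show "(theta ^^ Suc n) r t =
        (\<Sum>k = 1..2 * Suc n - 1. real (T_step n (T n) k) * t ^ k) /
          ((1 - t) ^ Suc n * (1 + t) ^ (Suc n - 1) * sqrt (1 - t ^ 2))"
      by (subst T_denominator[OF _ t]) simp_all
  qed
qed simp_all

lemma T_1: "T 1 = (\<lambda>k. if k = 1 then 1 else 0)"
proof (rule is_T_row_unique[OF _ is_T_row_T])
  have "theta r t = t / ((1 - t) * sqrt (1 - t ^ 2))" if t: "-1 < t" "t < 1" for t
    using T_denominator[of 1 t t] t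
    by (simp add: theta_def DERIV_imp_deriv[OF has_real_derivative_r])
  then show "is_T_row 1 (\<lambda>k. if k = 1 then 1 else 0)"
    unfolding is_T_row_def by auto
qed simp_all

section \<open>Iterates of D on x\<close>

lemma D_iterate_X:
  assumes "n \<ge> 1"
  shows "(D ^^ n) X = X * (\<Sum>k = 1..2 * n - 1. of_nat (T n k) * Y ^ k * Z ^ (2 * n - k))"
  using assms
proof (induction n rule: nat_induct_at_least)
  case base
  then show ?case unfolding T_1 by (simp add: D_X mult.assoc)
next
  case (Suc n)
  have n: "n \<ge> 1" using Suc.hyps by simp
  have T_support: "{k. T n k \<noteq> 0} \<subseteq> {1..2 * n - 1}"
    using is_T_row_T[OF n] unfolding is_T_row_def by blast
  have mon: "D (X * (Y ^ k * Z ^ m)) =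
      X * (Y ^ k * Z ^ m * (Y * Z + of_nat k * Z ^ 2 + of_nat m * Y ^ 2))" for k m
    by (simp only: D_mult[of X] D_X D_Y_Z_monomial) (simp add: algebra_simps)
  have "(D ^^ Suc n) X = D (\<Sum>k = 1..2 * n - 1. of_nat (T n k) * (X * (Y ^ k * Z ^ (2 * n - k))))"
    by (simp add: Suc.IH sum_distrib_left mult_ac)
  also have "\<dots> = X * (\<Sum>k = 1..2 * n - 1. of_nat (T n k) *
      (Y ^ k * Z ^ (2 * n - k) * (Y * Z + of_nat k * Z ^ 2 + of_nat (2 * n - k) * Y ^ 2)))"
    unfolding D_sum D_of_nat_mult mon sum_distrib_left by (simp only: mult.left_commute[of X])
  also have "\<dots> = X * (\<Sum>k = 1..2 * Suc n - 1. of_nat (T (Suc n) k) * Y ^ k * Z ^ (2 * Suc n - k))"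
    by (simp only: sum_T_step[OF T_support] T_Suc[OF n])
  finally show ?case .
qed

section \<open>Inserting a maximal entry into a permutation\<close>

text \<open>
  The cycle \<open>(j, n+1, n, ..., j+1)\<close>. If \<open>\<pi>\<close> permutes \<open>{1..n}\<close>, and hence fixes \<open>n + 1\<close>, then the word
  of \<open>\<pi> \<circ> insert_cycle n j\<close> is the word of \<open>\<pi>\<close> with \<open>n + 1\<close> inserted at position \<open>j\<close>. Writing the
  insertion as a composition makes it a permutation that can be undone by the inverse cycle.
\<close>

definition insert_cycle :: "nat \<Rightarrow> nat \<Rightarrow> nat \<Rightarrow> nat" where
  "insert_cycle n j i = (if i < j \<or> i > Suc n then i else if i = j then Suc n else i - 1)"

lemma insert_cycle_permutes:
  assumes "j \<in> {1..Suc n}"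
  shows "insert_cycle n j permutes {1..Suc n}"
proof -
  have "inj_on (insert_cycle n j) {1..Suc n}"
    by (auto simp: inj_on_def insert_cycle_def split: if_splits)
  moreover have "insert_cycle n j ` {1..Suc n} \<subseteq> {1..Suc n}"
    using assms by (auto simp: insert_cycle_def)
  ultimately have "bij_betw (insert_cycle n j) {1..Suc n} {1..Suc n}"
    by (simp add: bij_betw_def endo_inj_surj)
  then show ?thesis
    by (rule bij_imp_permutes) (use assms in \<open>auto simp: insert_cycle_def\<close>)
qed

text \<open>
  The position of insertion is recovered as the preimage of \<open>n + 1\<close>, and \<open>\<pi>\<close> by composing with the
  inverse cycle.
\<close>

lemma bij_betw_insert_max:
  "bij_betw (\<lambda>(\<pi>, j). \<pi> \<circ> insert_cycle n j)
     ({\<pi>. \<pi> permutes {1..n}} \<times> {1..Suc n}) {\<sigma>. \<sigma> permutes {1..Suc n}}"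
proof (rule bij_betwI')
  fix p q assume "p \<in> {\<pi>. \<pi> permutes {1..n}} \<times> {1..Suc n}"
    and "q \<in> {\<pi>. \<pi> permutes {1..n}} \<times> {1..Suc n}"
  then obtain \<pi> j \<rho> k where pq: "p = (\<pi>, j)" "q = (\<rho>, k)"
    and \<pi>: "\<pi> permutes {1..n}" and \<rho>: "\<rho> permutes {1..n}"
    and j: "j \<in> {1..Suc n}" and k: "k \<in> {1..Suc n}" by auto
  have "\<pi> = \<rho> \<and> j = k" if eq: "\<pi> \<circ> insert_cycle n j = \<rho> \<circ> insert_cycle n k"
  proof -
    have bij: "bij (insert_cycle n j)" "bij (\<rho> \<circ> insert_cycle n k)"
      using insert_cycle_permutes[OF j] insert_cycle_permutes[OF k] \<rho>
      by (auto intro: permutes_bij bij_comp)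
    have "(\<rho> \<circ> insert_cycle n k) j = Suc n"
      using permutes_not_in[OF \<pi>, of "Suc n"] j by (simp add: eq[symmetric] insert_cycle_def)
    moreover have "(\<rho> \<circ> insert_cycle n k) k = Suc n"
      using permutes_not_in[OF \<rho>, of "Suc n"] k by (simp add: insert_cycle_def)
    ultimately have jk: "j = k" using bij(2) by (metis bij_pointE)
    then have "\<pi> \<circ> insert_cycle n j = \<rho> \<circ> insert_cycle n j" using eq by simp
    then have "\<pi> = \<rho>" using bij(1) by (metis bij_is_surj fun.map_cong0 surj_fun_eq image_comp)
    then show ?thesis using jk by simp
  qed
  then show "((case p of (\<pi>, j) \<Rightarrow> \<pi> \<circ> insert_cycle n j) =
      (case q of (\<pi>, j) \<Rightarrow> \<pi> \<circ> insert_cycle n j)) = (p = q)"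
    using pq by auto
next
  fix p assume "p \<in> {\<pi>. \<pi> permutes {1..n}} \<times> {1..Suc n}"
  then show "(case p of (\<pi>, j) \<Rightarrow> \<pi> \<circ> insert_cycle n j) \<in> {\<sigma>. \<sigma> permutes {1..Suc n}}"
    using insert_cycle_permutes permutes_subset[of _ "{1..n}" "{1..Suc n}"]
    by (auto intro!: permutes_compose)
next
  fix \<sigma> assume "\<sigma> \<in> {\<sigma>. \<sigma> permutes {1..Suc n}}"
  then have \<sigma>: "\<sigma> permutes {1..Suc n}" by simp
  define j where "j = inv \<sigma> (Suc n)"
  have j: "j \<in> {1..Suc n}"
    unfolding j_def using permutes_in_image[OF permutes_inv[OF \<sigma>], of "Suc n"] by simp
  have \<sigma>j: "\<sigma> j = Suc n" unfolding j_def by (rule permutes_inverses(1)[OF \<sigma>])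
  note cyc = insert_cycle_permutes[OF j]
  define \<pi> where "\<pi> = \<sigma> \<circ> inv (insert_cycle n j)"
  have "inv (insert_cycle n j) (Suc n) = j"
    using permutes_inv_eq[OF cyc, of "Suc n" j] j by (simp add: insert_cycle_def)
  then have fixed: "\<pi> (Suc n) = Suc n" using \<sigma>j by (simp add: \<pi>_def)
  have "\<pi> permutes {1..Suc n}"
    unfolding \<pi>_def by (rule permutes_compose[OF permutes_inv[OF cyc] \<sigma>])
  then have "\<pi> permutes {1..n}"
    by (rule permutes_superset) (use fixed in \<open>auto simp: le_Suc_eq\<close>)
  moreover have "\<sigma> = \<pi> \<circ> insert_cycle n j"
    unfolding \<pi>_def using permutes_inv_o(2)[OF cyc] by (simp add: comp_assoc)
  ultimately show "\<exists>p\<in>{\<pi>. \<pi> permutes {1..n}} \<times> {1..Suc n}.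
      \<sigma> = (case p of (\<pi>, j) \<Rightarrow> \<pi> \<circ> insert_cycle n j)"
    using j by (intro bexI[of _ "(\<pi>, j)"]) auto
qed

text \<open>
  At the right end the new letter creates no descent. Elsewhere it is followed by a smaller letter
  and so creates one descent, but if it separates the two letters of a descent of \<open>\<pi>\<close>, that is,
  if \<open>j - 1\<close> is a descent, the old descent is lost at the same time.
\<close>

lemma des_insert_max:
  assumes \<pi>: "\<pi> permutes {1..n}" and j: "j \<in> {1..Suc n}"
  shows "des (Suc n) (\<pi> \<circ> insert_cycle n j) =
    (if j \<in> insert (Suc n) (Suc ` {i \<in> {1..<n}. \<pi> i > \<pi> (i + 1)}) then des n \<pi> else Suc (des n \<pi>))"
proof -
  define E where "E = {i \<in> {1..<n}. \<pi> i > \<pi> (i + 1)}"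
  let ?s = "\<pi> \<circ> insert_cycle n j"
  have finE: "finite E" unfolding E_def by simp
  have le: "\<pi> i \<le> n" if "i \<in> {1..n}" for i
    using permutes_in_image[OF \<pi>, of i] that by simp
  have top: "\<pi> (Suc n) = Suc n" by (rule permutes_not_in[OF \<pi>]) simp
  \<comment> \<open>Descents of \<open>\<pi>\<close> lie strictly before the place of insertion (\<open>P\<close>), after it (\<open>Q\<close>, moved by one
    in the new word), or across it (\<open>K\<close> below, lost); \<open>J\<close> is the descent after the new letter.\<close>
  define P where "P = {i \<in> E. i < j - 1}"
  define Q where "Q = {i \<in> E. i \<ge> j}"
  define J where "J = (if j \<le> n then {j} else {})"
  have "{i \<in> {1..<Suc n}. ?s i > ?s (i + 1)} = P \<union> (J \<union> Suc ` Q)" (is "?L = ?R")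
  proof (rule set_eqI)
    fix i
    consider "i = 0 \<or> i > n" | "1 \<le> i" "i \<le> n" "Suc i < j" | "1 \<le> i" "i \<le> n" "Suc i = j"
      | "1 \<le> i" "i \<le> n" "i = j" | "1 \<le> i" "i \<le> n" "i > j" by linarith
    then show "i \<in> ?L \<longleftrightarrow> i \<in> ?R"
    proof cases
      case 5
      then obtain m where "i = Suc m" by (cases i) auto
      then show ?thesis using 5 j
        by (auto simp: P_def Q_def J_def E_def insert_cycle_def image_iff)
    qed (use j le[of i] le[of j] top in
        \<open>auto simp: P_def Q_def J_def E_def insert_cycle_def image_iff\<close>)
  qed
  then have "des (Suc n) ?s = card (P \<union> (J \<union> Suc ` Q))" by (simp add: des_def)
  also have "\<dots> = card P + (card J + card Q)"
  proof -
    have "finite P" "finite Q" "finite J" using finE by (simp_all add: P_def Q_def J_def)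
    moreover have "P \<inter> (J \<union> Suc ` Q) = {}" "J \<inter> Suc ` Q = {}"
      by (auto simp: P_def Q_def J_def)
    ultimately show ?thesis by (simp add: card_Un_disjoint card_image)
  qed
  finally have des_s: "des (Suc n) ?s = card P + (card J + card Q)" .
  define K where "K = {i \<in> E. Suc i = j}"
  have "E = P \<union> (K \<union> Q)" using j by (auto simp: P_def Q_def K_def E_def)
  then have "des n \<pi> = card (P \<union> (K \<union> Q))" by (simp add: des_def E_def)
  also have "\<dots> = card P + (card K + card Q)"
  proof -
    have "finite P" "finite Q" "finite K" using finE by (simp_all add: P_def Q_def K_def)
    moreover have "P \<inter> (K \<union> Q) = {}" "K \<inter> Q = {}"
      by (auto simp: P_def Q_def K_def)
    ultimately show ?thesis by (simp add: card_Un_disjoint)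
  qed
  finally have des_p: "des n \<pi> = card P + (card K + card Q)" .
  consider "j = Suc n" | "j \<in> Suc ` E" "j \<le> n" | "j \<notin> Suc ` E" "j \<le> n" using j by force
  then show ?thesis
  proof cases
    case 1
    then have "K = {}" "J = {}" by (auto simp: K_def J_def E_def)
    then show ?thesis using 1 des_s des_p by simp
  next
    case 2
    then have "K = {j - 1}" "J = {j}" by (auto simp: K_def J_def)
    then show ?thesis using 2 des_s des_p by (simp add: E_def)
  next
    case 3
    then have "K = {}" "J = {j}" by (auto simp: K_def J_def)
    then show ?thesis using 3 des_s des_p by (simp add: E_def)
  qed
qed

text \<open>
  The distribution form of the Eulerian recurrence: a permutation with \<open>d\<close> descents has \<open>d + 1\<close>
  places where the largest letter can be inserted without a new descent (its \<open>d\<close> descents and the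
  right end), and \<open>n - d\<close> remaining ones. With arbitrary weights \<open>f\<close> it applies directly to the
  homogeneous Eulerian polynomial.
\<close>

lemma sum_des_Suc:
  fixes f :: "nat \<Rightarrow> 'a :: comm_semiring_1"
  shows "(\<Sum>\<sigma> | \<sigma> permutes {1..Suc n}. f (des (Suc n) \<sigma>)) =
    (\<Sum>\<pi> | \<pi> permutes {1..n}. of_nat (des n \<pi> + 1) * f (des n \<pi>) +
       of_nat (n - des n \<pi>) * f (des n \<pi> + 1))"
proof -
  have "(\<Sum>\<sigma> | \<sigma> permutes {1..Suc n}. f (des (Suc n) \<sigma>)) =
      (\<Sum>(\<pi>, j)\<in>{\<pi>. \<pi> permutes {1..n}} \<times> {1..Suc n}. f (des (Suc n) (\<pi> \<circ> insert_cycle n j)))"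
    by (subst sum.reindex_bij_betw[OF bij_betw_insert_max, symmetric]) (simp add: case_prod_beta)
  also have "\<dots> = (\<Sum>\<pi> | \<pi> permutes {1..n}. \<Sum>j = 1..Suc n. f (des (Suc n) (\<pi> \<circ> insert_cycle n j)))"
    by (rule sum.cartesian_product[symmetric])
  also have "\<dots> = (\<Sum>\<pi> | \<pi> permutes {1..n}. of_nat (des n \<pi> + 1) * f (des n \<pi>) +
       of_nat (n - des n \<pi>) * f (des n \<pi> + 1))"
  proof (rule sum.cong[OF refl])
    fix \<pi> assume "\<pi> \<in> {\<pi>. \<pi> permutes {1..n}}"
    then have \<pi>: "\<pi> permutes {1..n}" by simp
    \<comment> \<open>The places of insertion that preserve the number of descents.\<close>
    define B where "B = insert (Suc n) (Suc ` {i \<in> {1..<n}. \<pi> i > \<pi> (i + 1)})"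
    have B: "B \<subseteq> {1..Suc n}" "finite B" unfolding B_def by auto
    have cardB: "card B = des n \<pi> + 1"
      unfolding B_def des_def by (subst card_insert_disjoint) (auto simp: card_image)
    have "(\<Sum>j = 1..Suc n. f (des (Suc n) (\<pi> \<circ> insert_cycle n j))) =
        (\<Sum>j = 1..Suc n. if j \<in> B then f (des n \<pi>) else f (des n \<pi> + 1))"
      by (rule sum.cong[OF refl]) (simp add: des_insert_max[OF \<pi>] B_def)
    also have "\<dots> = of_nat (card B) * f (des n \<pi>) + of_nat (card ({1..Suc n} - B)) * f (des n \<pi> + 1)"
      by (simp only: sum.If_cases[OF finite_atLeastAtMost] Collect_mem_eq Int_absorb1[OF B(1)]
          Diff_eq[symmetric] sum_constant)
    also have "card ({1..Suc n} - B) = n - des n \<pi>"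
      using B by (simp add: card_Diff_subset cardB)
    finally show "(\<Sum>j = 1..Suc n. f (des (Suc n) (\<pi> \<circ> insert_cycle n j))) =
        of_nat (des n \<pi> + 1) * f (des n \<pi>) + of_nat (n - des n \<pi>) * f (des n \<pi> + 1)"
      by (simp only: cardB)
  qed
  finally show ?thesis .
qed

section \<open>Iterates of D on the square of x\<close>

lemma des_less: "n \<ge> 1 \<Longrightarrow> des n \<pi> < n"
proof -
  assume "n \<ge> 1"
  moreover have "des n \<pi> \<le> card {1..<n}" unfolding des_def by (rule card_mono) auto
  ultimately show ?thesis by simp
qed

lemma sum_eulerian:
  fixes f :: "nat \<Rightarrow> 'a :: comm_semiring_1"
  assumes "n \<ge> 1"
  shows "(\<Sum>k = 1..n. of_nat (eulerian n k) * f k) = (\<Sum>\<pi> | \<pi> permutes {1..n}. f (des n \<pi> + 1))"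
proof -
  let ?P = "{\<pi>. \<pi> permutes {1..n}}"
  have "(\<Sum>\<pi>\<in>?P. f (des n \<pi> + 1)) = (\<Sum>k = 1..n. \<Sum>\<pi> | \<pi> \<in> ?P \<and> des n \<pi> + 1 = k. f (des n \<pi> + 1))"
    using des_less[OF assms] by (intro sum.group[symmetric]) (auto simp: finite_permutations Suc_le_eq)
  also have "\<dots> = (\<Sum>k = 1..n. of_nat (eulerian n k) * f k)"
  proof (rule sum.cong[OF refl])
    fix k
    have "(\<Sum>\<pi> | \<pi> \<in> ?P \<and> des n \<pi> + 1 = k. f (des n \<pi> + 1)) = (\<Sum>\<pi> | \<pi> \<in> ?P \<and> des n \<pi> + 1 = k. f k)"
      by (rule sum.cong) auto
    then show "(\<Sum>\<pi> | \<pi> \<in> ?P \<and> des n \<pi> + 1 = k. f (des n \<pi> + 1)) = of_nat (eulerian n k) * f k"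
      by (simp add: eulerian_def)
  qed
  finally show ?thesis ..
qed

text \<open>
  By the product rule, one application of \<open>D\<close> to \<open>x^2 (y + z)^(n-1)\<close> yields the factor
  \<open>2 y z + (n - 1) y z = (n + 1) y z\<close>. The induction step therefore reduces to
  \<open>D(A_n) + (n + 1) y z A_n = (y + z) A_(n+1)\<close>, which is checked permutation by permutation.
\<close>

lemma D_iterate_X_squared:
  assumes "n \<ge> 1"
  shows "(D ^^ n) (X ^ 2) = 2 * X ^ 2 * (Y + Z) ^ (n - 1) *
    (\<Sum>k = 1..n. of_nat (eulerian n k) * Y ^ k * Z ^ (n - k + 1))"
proof -
  define A where "A n = (\<Sum>\<pi> | \<pi> permutes {1..n}. Y ^ (des n \<pi> + 1) * Z ^ (n - des n \<pi>))" for n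
  have sq: "D (X ^ 2) = of_nat 2 * (X ^ 2 * (Y * Z))"
    by (rule D_power) (simp add: D_X mult.assoc)
  have "(D ^^ n) (X ^ 2) = of_nat 2 * (X ^ 2 * (Y + Z) ^ (n - 1) * A n)"
    using assms
  proof (induction n rule: nat_induct_at_least)
    case base
    have "des 1 \<pi> = 0" for \<pi> using des_less[of 1 \<pi>] by simp
    then have "A 1 = Y * Z" by (simp add: A_def)
    then show ?case by (simp add: sq)
  next
    case (Suc n)
    have n: "n \<ge> 1" using Suc.hyps by simp
    have step: "D (A n) + of_nat (n + 1) * (Y * Z) * A n = (Y + Z) * A (Suc n)"
    proof -
      have "D (A n) + of_nat (n + 1) * (Y * Z) * A n =
        (\<Sum>\<pi> | \<pi> permutes {1..n}. (Y + Z) *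
          (of_nat (des n \<pi> + 1) * (Y ^ (des n \<pi> + 1) * Z ^ (Suc n - des n \<pi>)) +
           of_nat (n - des n \<pi>) * (Y ^ (des n \<pi> + 1 + 1) * Z ^ (Suc n - (des n \<pi> + 1)))))"
        unfolding A_def D_sum sum_distrib_left sum.distrib[symmetric] D_Y_Z_monomial
      proof (rule sum.cong[OF refl])
        fix \<pi>
        define k where "k = des n \<pi> + 1"
        define m where "m = n - des n \<pi>"
        have km: "n + 1 = k + m" "Suc n - des n \<pi> = Suc m" "Suc n - k = m"
          using des_less[OF n, of \<pi>] by (simp_all add: k_def m_def)
        \<comment> \<open>This is \<open>(k + m) y z + k z^2 + m y^2 = (y + z) (k z + m y)\<close>, multiplied by
          \<open>y^k z^m\<close>.\<close>
        show "Y ^ (des n \<pi> + 1) * Z ^ (n - des n \<pi>) *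
            (of_nat (des n \<pi> + 1) * Z\<^sup>2 + of_nat (n - des n \<pi>) * Y\<^sup>2) +
            of_nat (n + 1) * (Y * Z) * (Y ^ (des n \<pi> + 1) * Z ^ (n - des n \<pi>)) =
          (Y + Z) *
          (of_nat (des n \<pi> + 1) * (Y ^ (des n \<pi> + 1) * Z ^ (Suc n - des n \<pi>)) +
           of_nat (n - des n \<pi>) * (Y ^ (des n \<pi> + 1 + 1) * Z ^ (Suc n - (des n \<pi> + 1))))"
          unfolding km k_def[symmetric] m_def[symmetric]
          by (simp add: algebra_simps power2_eq_square)
      qed
      also have "\<dots> = (Y + Z) * A (Suc n)"
        unfolding A_def sum_distrib_left[symmetric]
        by (subst sum_des_Suc[where f = "\<lambda>d. Y ^ (d + 1) * Z ^ (Suc n - d)"]) simp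
      finally show ?thesis .
    qed
    have "D (Y + Z) = (Y + Z) * (Y * Z)"
      by (simp add: D_add D_Y D_Z algebra_simps power2_eq_square)
    then have YZ: "D ((Y + Z) ^ (n - 1)) = of_nat (n - 1) * ((Y + Z) ^ (n - 1) * (Y * Z))"
      by (rule D_power)
    have n': "of_nat (n + 1) = of_nat 2 + (of_nat (n - 1) :: ring_xyz)"
      using n by (simp flip: of_nat_add)
    have "(D ^^ Suc n) (X ^ 2) = of_nat 2 * D (X ^ 2 * (Y + Z) ^ (n - 1) * A n)"
      by (simp only: funpow.simps o_apply Suc.IH D_of_nat_mult)
    also have "D (X ^ 2 * (Y + Z) ^ (n - 1) * A n) =
        X ^ 2 * (Y + Z) ^ (n - 1) * (D (A n) + of_nat (n + 1) * (Y * Z) * A n)"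
      unfolding n' D_mult sq YZ by (simp only: distrib_left distrib_right ac_simps)
    also have "\<dots> = X ^ 2 * (Y + Z) ^ (Suc n - 1) * A (Suc n)"
      unfolding step using n by (cases n) (simp_all add: mult_ac)
    finally show ?case .
  qed
  also have "A n = (\<Sum>k = 1..n. of_nat (eulerian n k) * Y ^ k * Z ^ (n - k + 1))"
  proof -
    have "n - des n \<pi> = n - (des n \<pi> + 1) + 1" for \<pi> using des_less[OF assms, of \<pi>] by simp
    then show ?thesis
      unfolding A_def mult.assoc
      by (subst sum_eulerian[OF assms, where f = "\<lambda>k. Y ^ k * Z ^ (n - k + 1)"]) simp
  qed
  finally show ?thesis by (simp add: mult.assoc)
qed

section \<open>Specialisation at x = z = 1\<close>

lemma at_xz_1_simps:
  "at_xz_1 (u + v) = at_xz_1 u + at_xz_1 v"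
  "at_xz_1 (u * v) = at_xz_1 u * at_xz_1 v"
  "at_xz_1 (u ^ k) = at_xz_1 u ^ k"
  "at_xz_1 (sum f A) = (\<Sum>a\<in>A. at_xz_1 (f a))"
  "at_xz_1 (of_nat m) = of_nat m"
  "at_xz_1 (numeral a) = numeral a"
  "at_xz_1 X = 1" "at_xz_1 Y = [:0, 1:]" "at_xz_1 Z = 1"
  by (simp_all add: at_xz_1_def poly_sum X_def Y_def Z_def)

lemma of_nat_mult_pX_power: "of_nat m * [:0, 1:] ^ k = monom (of_nat m) k"
  by (simp add: monom_altdef of_nat_poly)

theorem theorem5:
  fixes n :: nat
  assumes "n \<ge> 1"
  shows "(D ^^ n) X = X * (\<Sum>k = 1..2 * n - 1. of_nat (T n k) * Y ^ k * Z ^ (2 * n - k)) \<and>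
    (D ^^ n) (X ^ 2) =
      2 * X ^ 2 * (Y + Z) ^ (n - 1) * (\<Sum>k = 1..n. of_nat (eulerian n k) * Y ^ k * Z ^ (n - k + 1)) \<and>
    at_xz_1 ((D ^^ n) X) = T_poly n \<and>
    at_xz_1 ((D ^^ n) (X ^ 2)) = 2 * (1 + [:0, 1:]) ^ (n - 1) * eulerian_poly n"
proof (intro conjI)
  show "at_xz_1 ((D ^^ n) X) = T_poly n"
    unfolding D_iterate_X[OF assms] T_poly_def by (simp add: at_xz_1_simps of_nat_mult_pX_power)
  show "at_xz_1 ((D ^^ n) (X ^ 2)) = 2 * (1 + [:0, 1:]) ^ (n - 1) * eulerian_poly n"
    unfolding D_iterate_X_squared[OF assms] eulerian_poly_conv_eulerian[OF assms]
    by (simp add: at_xz_1_simps of_nat_mult_pX_power add.commute)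
qed (fact D_iterate_X[OF assms] D_iterate_X_squared[OF assms])+

end
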